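(* Let $H_1,H_2$ be complex Hilbert spaces and let $A:\mathcal D(A)\subset H_1\to H_1$, $B:\mathcal D(B)\subset H_2\to H_1$, $C:\mathcal D(C)\subset H_1\to H_2$, $D:\mathcal D(D)\subset H_2\to H_2$ be densely defined closable linear operators with $A\subset A^*$, $B\subset C^*$, $D\subset D^*$, such that the block operator matrix $\mathcal A=\begin{pmatrix}A&B\\C&D\end{pmatrix}$ is densely defined on $H_1\times H_2$. Then: (a) If $D=D^*$ and $\mathcal D(D)\subset\mathcal D(B)$, then $\mathcal A$ is self-adjoint if and only if $$(A-B(D-\lambda)^{-1}C)^*=A-B(D-\overline{\lambda})^{-1}C$$ for some (and hence for all) $\lambda\in\rho(D)$. (b) If $A=A^*$ and $\mathcal D(A)\subset\mathcal D(C)$, then $\mathcal A$ is self-adjoint if and only if $$(D-C(A-\lambda)^{-1}B)^*=D-C(A-\overline{\lambda})^{-1}B$$ for some (and hence for all) $\lambda\in\rho(A)$. Here "for some (and hence for all)" means that the displayed equality for one $\lambda$ in the resolvent set is equivalent to self-adjointness of $\mathcal A$, and also to the displayed equality for every $\lambda$ in the resolvent set.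
   Context: All operators are linear and possibly unbounded; $\mathcal D(T)$ is the domain and $\rho(T)$ the resolvent set of $T$; $S\subset T$ means that $T$ extends $S$. The block operator matrix $\mathcal A=\begin{pmatrix}A&B\\C&D\end{pmatrix}$ is identified with the operator on $H_1\times H_2$ with domain $(\mathcal D(A)\cap\mathcal D(C))\times(\mathcal D(B)\cap\mathcal D(D))$ and action $(x_1\ x_2)^t\mapsto(Ax_1+Bx_2\ \ Cx_1+Dx_2)^t$. Sums and products of operators have their natural domains; thus in (a) $A-B(D-\lambda)^{-1}C$ has domain $\mathcal D(A)\cap\mathcal D(C)$ and in (b) $D-C(A-\lambda)^{-1}B$ has domain $\mathcal D(B)\cap\mathcal D(D)$. *)

theory Defs
  imports "HOL-Analysis.Analysis"
begin

section \<open>Complex Hilbert spaces\<close>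

text \<open>
  The complex structure is put on top of the library's real one: the norm, the metric and the
  topology of a complex inner product space are those of the real inner product
  \<^term>\<open>inner x y\<close>, which is the real part of the complex one.
  The complex inner product is linear in the first argument.
\<close>

class complex_vector = real_vector +
  fixes scaleC :: "complex \<Rightarrow> 'a \<Rightarrow> 'a"  (infixr \<open>*\<^sub>C\<close> 75)
  assumes scaleC_add_right: "c *\<^sub>C (x + y) = c *\<^sub>C x + c *\<^sub>C y"
    and scaleC_add_left: "(c + d) *\<^sub>C x = c *\<^sub>C x + d *\<^sub>C x"
    and scaleC_scaleC: "c *\<^sub>C d *\<^sub>C x = (c * d) *\<^sub>C x"
    and scaleR_scaleC: "r *\<^sub>R x = complex_of_real r *\<^sub>C x"

class complex_inner = complex_vector + real_inner +
  fixes cinner :: "'a \<Rightarrow> 'a \<Rightarrow> complex"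
  assumes cinner_commute: "cinner x y = cnj (cinner y x)"
    and cinner_add_left: "cinner (x + y) z = cinner x z + cinner y z"
    and cinner_scaleC_left: "cinner (c *\<^sub>C x) y = c * cinner x y"
    and inner_eq_Re_cinner: "inner x y = Re (cinner x y)"

class chilbert_space = complex_inner + complete_space

lemma scaleC_one: "1 *\<^sub>C x = (x :: 'a::complex_vector)"
  using scaleR_scaleC[of 1 x] by simp

lemma cinner_self: "cinner x x = complex_of_real ((norm x)\<^sup>2)" for x :: "'a::complex_inner"
proof (rule complex_eqI)
  show "Re (cinner x x) = Re (complex_of_real ((norm x)\<^sup>2))"
    by (simp add: inner_eq_Re_cinner[symmetric] power2_norm_eq_inner)
  show "Im (cinner x x) = Im (complex_of_real ((norm x)\<^sup>2))"
    using arg_cong[OF cinner_commute[of x x], of Im] by simp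
qed

instantiation complex :: chilbert_space
begin

definition "scaleC c z = c * (z :: complex)"
definition "cinner z w = z * cnj (w :: complex)"

instance
  by standard
    (simp_all add: scaleC_complex_def cinner_complex_def inner_complex_def scaleR_conv_of_real
      algebra_simps)

end

instantiation prod :: (complex_vector, complex_vector) complex_vector
begin

definition "scaleC c p = (c *\<^sub>C fst p, c *\<^sub>C snd p)"

instance
  by standard
    (simp_all add: scaleC_prod_def scaleR_prod_def scaleC_add_right scaleC_add_left scaleC_scaleC
      scaleR_scaleC)

end

instantiation prod :: (complex_inner, complex_inner) complex_inner
begin

definition "cinner p q = cinner (fst p) (fst q) + cinner (snd p) (snd q)"

instance
proof
  fix p q :: "'a \<times> 'b"
  show "cinner p q = cnj (cinner q p)"
    unfolding cinner_prod_def complex_cnj_add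
    by (metis cinner_commute)
qed (simp_all add: cinner_prod_def scaleC_prod_def inner_prod_def cinner_add_left
      cinner_scaleC_left inner_eq_Re_cinner algebra_simps)

end

instance prod :: (chilbert_space, chilbert_space) chilbert_space ..


section \<open>Unbounded operators\<close>

text \<open>
  An operator is a partial function \<^typ>\<open>'a \<rightharpoonup> 'b\<close>. Its domain is \<^term>\<open>dom T\<close>, its value
  at \<^term>\<open>x \<in> dom T\<close> is \<^term>\<open>the (T x)\<close>, equality of operators is equality of partial functions
  (so it includes equality of domains), \<open>S \<subset> T\<close> is \<^term>\<open>S \<subseteq>\<^sub>m T\<close>, and the product on its
  natural domain is \<^term>\<open>S \<circ>\<^sub>m T\<close>.
\<close>

definition linear_op :: "('a::complex_vector \<rightharpoonup> 'b::complex_vector) \<Rightarrow> bool" where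
  "linear_op T \<longleftrightarrow>
     T 0 = Some 0 \<and>
     (\<forall>x y u v. T x = Some u \<longrightarrow> T y = Some v \<longrightarrow> T (x + y) = Some (u + v)) \<and>
     (\<forall>c x u. T x = Some u \<longrightarrow> T (c *\<^sub>C x) = Some (c *\<^sub>C u))"

definition densely_defined :: "('a::topological_space \<rightharpoonup> 'b) \<Rightarrow> bool" where
  "densely_defined T \<longleftrightarrow> closure (dom T) = UNIV"

definition closable_op :: "('a::topological_space \<rightharpoonup> 'b::topological_space) \<Rightarrow> bool" where
  "closable_op T \<longleftrightarrow> single_valued (closure (Map.graph T))"

definition op_minus :: "('a \<rightharpoonup> 'b::minus) \<Rightarrow> ('a \<rightharpoonup> 'b) \<Rightarrow> ('a \<rightharpoonup> 'b)"  (infixl \<open>-\<^sub>o\<close> 65) where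
  "S -\<^sub>o T = (\<lambda>x. if x \<in> dom S \<inter> dom T then Some (the (S x) - the (T x)) else None)"

definition scalar_op :: "complex \<Rightarrow> ('a::complex_vector \<rightharpoonup> 'a)" where
  "scalar_op c = (\<lambda>x. Some (c *\<^sub>C x))"

text \<open>Meaningful only for injective \<^term>\<open>T\<close>, where the \<open>THE\<close> is well defined.\<close>

definition op_inverse :: "('a \<rightharpoonup> 'b) \<Rightarrow> ('b \<rightharpoonup> 'a)" where
  "op_inverse T = (\<lambda>y. if y \<in> ran T then Some (THE x. T x = Some y) else None)"

definition resolvent_op :: "('a::complex_vector \<rightharpoonup> 'a) \<Rightarrow> complex \<Rightarrow> ('a \<rightharpoonup> 'a)" where
  "resolvent_op T c = op_inverse (T -\<^sub>o scalar_op c)"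

definition resolvent_set :: "('a::complex_inner \<rightharpoonup> 'a) \<Rightarrow> complex set" where
  "resolvent_set T =
     {c. inj_on (T -\<^sub>o scalar_op c) (dom (T -\<^sub>o scalar_op c)) \<and>
         ran (T -\<^sub>o scalar_op c) = UNIV \<and>
         bounded_linear (\<lambda>y. the (resolvent_op T c y))}"

text \<open>Meaningful only for densely defined \<^term>\<open>T\<close>, where \<open>z\<close> is unique.\<close>

definition adjoint_op :: "('a::complex_inner \<rightharpoonup> 'b::complex_inner) \<Rightarrow> ('b \<rightharpoonup> 'a)" where
  "adjoint_op T =
     (\<lambda>y. if \<exists>z. \<forall>x\<in>dom T. cinner (the (T x)) y = cinner x z
          then Some (THE z. \<forall>x\<in>dom T. cinner (the (T x)) y = cinner x z)
          else None)"

definition self_adjoint :: "('a::complex_inner \<rightharpoonup> 'a) \<Rightarrow> bool" where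
  "self_adjoint T \<longleftrightarrow> densely_defined T \<and> T = adjoint_op T"

definition block_op ::
  "('a \<rightharpoonup> 'a::plus) \<Rightarrow> ('b \<rightharpoonup> 'a) \<Rightarrow> ('a \<rightharpoonup> 'b::plus) \<Rightarrow> ('b \<rightharpoonup> 'b) \<Rightarrow> ('a \<times> 'b \<rightharpoonup> 'a \<times> 'b)" where
  "block_op A B C D =
     (\<lambda>(x, y). if x \<in> dom A \<inter> dom C \<and> y \<in> dom B \<inter> dom D
               then Some (the (A x) + the (B y), the (C x) + the (D y))
               else None)"

end

theory Submission
  imports Defs
begin

text \<open>
  Let \<open>D\<close> be self-adjoint, \<open>R = (D - \<lambda>)\<^sup>-\<^sup>1\<close>, \<open>R' = (D - cnj \<lambda>)\<^sup>-\<^sup>1\<close>, and let \<open>S(\<lambda>) = A - B R C\<close>. Then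
  \<open>R'C \<subset> (BR)\<^sup>*\<close>. If \<open>(u, v)\<close> lies in the domain of the adjoint of the block operator, with value
  \<open>(f, g)\<close>, then \<open>(BR)\<^sup>*u = R'(g - cnj \<lambda> v) - v\<close> and
  \<open>S(\<lambda>)\<^sup>*u = f - B R'(g - cnj \<lambda> v)\<close>; so if \<open>S(\<lambda>)\<^sup>* = S(cnj \<lambda>)\<close>, then
  \<open>u \<in> dom A \<inter> dom C\<close> and \<open>v = R'(g - cnj \<lambda> v) - R'Cu \<in> dom D\<close>. Conversely, \<open>BR\<close> is bounded
  (uniform boundedness), and if \<open>S(\<lambda>)\<^sup>*u = h\<close>, then the adjoint of the block operator maps
  \<open>(u, -v)\<close> to \<open>(h, -cnj \<lambda> v)\<close> for \<open>v = (BR)\<^sup>*u\<close>. The resolvent set is nonempty, as \<open>\<i>\<close> is in the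
  resolvent set of a self-adjoint operator. Part (b) is part (a) with the two spaces exchanged.
\<close>

section \<open>Projections and uniform boundedness in Hilbert spaces\<close>

text \<open>Moving from \<open>p\<close> along \<open>k\<close> cannot come closer to
  \<open>x\<close>, so the linear coefficient of the squared distance in the step length must
  vanish.\<close>

lemma closest_point_subspace_orthogonal:
  fixes M :: "'a::real_inner set"
  assumes "subspace M" "p \<in> M" and min: "\<And>k. k \<in> M \<Longrightarrow> norm (x - p) \<le> norm (x - k)" and "k \<in> M"
  shows "inner (x - p) k = 0"
proof (cases "k = 0")
  case False
  \<comment> \<open>This \<open>t\<close> minimises the distance from \<open>x - p\<close> to the
    line spanned by \<open>k\<close>; the squared distance drops by exactly the quotient in the
    final estimate.\<close>
  define t where "t = inner (x - p) k / inner k k"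
  have "p + t *\<^sub>R k \<in> M"
    using assms by (simp add: subspace_add subspace_scale)
  then have "norm (x - p) \<le> norm ((x - p) - t *\<^sub>R k)"
    using min by (metis diff_diff_eq)
  then have "(norm (x - p))\<^sup>2 \<le> (norm ((x - p) - t *\<^sub>R k))\<^sup>2"
    by (simp add: power_mono)
  also have "\<dots> = (norm (x - p))\<^sup>2 - 2 * t * inner (x - p) k + t * t * inner k k"
    by (simp only: power2_norm_eq_inner inner_diff_left[of "x - p"] inner_diff_right[of _ "x - p"])
      (simp add: inner_commute algebra_simps)
  also have "\<dots> = (norm (x - p))\<^sup>2 - (inner (x - p) k)\<^sup>2 / inner k k"
    using False by (simp add: t_def power2_eq_square)
  finally have "(inner (x - p) k)\<^sup>2 / inner k k \<le> 0" by simp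
  moreover have "inner k k > 0" using False by simp
  ultimately show ?thesis by (simp add: divide_le_0_iff)
qed simp

lemma parallelogram_law:
  fixes a b :: "'a::real_inner"
  shows "(norm (a - b))\<^sup>2 + (norm (a + b))\<^sup>2 = 2 * (norm a)\<^sup>2 + 2 * (norm b)\<^sup>2"
  by (simp add: power2_norm_eq_inner inner_diff_left inner_diff_right inner_add_left inner_add_right)

text \<open>A sequence in \<open>M\<close> that minimises the distance to \<open>x\<close> is Cauchy
  by the parallelogram law; closedness puts its limit, a nearest point, into
  \<open>M\<close>.\<close>

lemma orthogonal_projection_exists:
  fixes M :: "'a::{real_inner, complete_space} set"
  assumes sub: "subspace M" and "closed M"
  obtains p where "p \<in> M" "\<And>k. k \<in> M \<Longrightarrow> inner (x - p) k = 0"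
proof -
  define d where "d = infdist x M"
  have ne: "M \<noteq> {}" using sub subspace_0 by blast
  have d: "d \<ge> 0" "\<And>k. k \<in> M \<Longrightarrow> d \<le> norm (x - k)"
    unfolding d_def by (simp_all add: infdist_nonneg infdist_le flip: dist_norm)
  have "\<exists>m\<in>M. norm (x - m) < d + 1 / Suc n" for n
  proof (rule ccontr)
    assume "\<not> ?thesis"
    then have "d + 1 / Suc n \<le> infdist x M"
      using ne by (auto simp: infdist_notempty dist_norm not_less intro!: cINF_greatest)
    then show False by (simp add: d_def)
  qed
  then obtain m where m: "\<And>n. m n \<in> M" "\<And>n. norm (x - m n) < d + 1 / Suc n"
    by metis
  \<comment> \<open>The midpoint of \<open>m i\<close> and \<open>m j\<close> lies in
    \<open>M\<close>, hence at distance at least \<open>d\<close> from \<open>x\<close>. The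
    parallelogram law then bounds the left side by four times the bound
    \<open>(2 * d + 1) / Suc n\<close> on the excess of the squared distances over
    \<open>d\<^sup>2\<close>.\<close>
  have gap: "(norm (m i - m j))\<^sup>2 \<le> (8 * d + 4) / Suc n" if "n \<le> i" "n \<le> j" for i j n
  proof -
    have close: "(norm (x - m k))\<^sup>2 \<le> d\<^sup>2 + (2 * d + 1) / Suc n" if "n \<le> k" for k
    proof -
      have "1 / real (Suc k) \<le> 1 / Suc n" using that by (simp add: frac_le)
      then have "norm (x - m k) \<le> d + 1 / Suc n" using m(2)[of k] by linarith
      then have "(norm (x - m k))\<^sup>2 \<le> (d + 1 / Suc n)\<^sup>2" by (simp add: power_mono)
      also have "\<dots> = d\<^sup>2 + 2 * d / Suc n + 1 / Suc n * (1 / Suc n)"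
        by (simp add: power2_eq_square algebra_simps)
      also have "\<dots> \<le> d\<^sup>2 + 2 * d / Suc n + 1 / Suc n * 1"
        by (intro add_left_mono mult_left_mono) auto
      also have "\<dots> = d\<^sup>2 + (2 * d + 1) / Suc n"
        by (simp add: add_divide_distrib)
      finally show ?thesis .
    qed
    have "(1/2) *\<^sub>R (m i + m j) \<in> M"
      using sub m(1) by (simp add: subspace_add subspace_scale)
    then have "d \<le> norm (x - (1/2) *\<^sub>R (m i + m j))" by (rule d)
    then have "d\<^sup>2 \<le> (norm (x - (1/2) *\<^sub>R (m i + m j)))\<^sup>2"
      using d(1) by (simp add: power_mono)
    moreover have "4 * (norm (x - (1/2) *\<^sub>R (m i + m j)))\<^sup>2 = (norm ((x - m i) + (x - m j)))\<^sup>2"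
    proof -
      have "(x - m i) + (x - m j) = 2 *\<^sub>R (x - (1/2) *\<^sub>R (m i + m j))"
        by (simp add: scaleR_diff_right scaleR_2)
      then show ?thesis by (simp add: power_mult_distrib)
    qed
    moreover have "(norm (m i - m j))\<^sup>2 + (norm ((x - m i) + (x - m j)))\<^sup>2
        = 2 * (norm (x - m i))\<^sup>2 + 2 * (norm (x - m j))\<^sup>2"
      using parallelogram_law[of "x - m j" "x - m i"] by (simp add: add.commute)
    ultimately have "(norm (m i - m j))\<^sup>2 \<le> 4 * ((2 * d + 1) / Suc n)"
      using close[OF that(1)] close[OF that(2)] by linarith
    then show ?thesis by simp
  qed
  have "Cauchy m"
  proof (rule metric_CauchyI)
    fix e :: real assume "e > 0"
    then obtain n where n: "(8 * d + 4) / e\<^sup>2 < real n"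
      using reals_Archimedean2 by blast
    have "dist (m i) (m j) < e" if "n \<le> i" "n \<le> j" for i j
    proof -
      have "(8 * d + 4) / Suc n < e\<^sup>2"
      proof -
        have "(8 * d + 4) / e\<^sup>2 < real (Suc n)" using n by simp
        then show ?thesis using \<open>e > 0\<close> by (simp add: field_simps del: of_nat_Suc)
      qed
      then have "(norm (m i - m j))\<^sup>2 < e\<^sup>2" using gap[OF that] by linarith
      then show ?thesis using \<open>e > 0\<close> by (simp add: dist_norm power_less_imp_less_base)
    qed
    then show "\<exists>n. \<forall>i\<ge>n. \<forall>j\<ge>n. dist (m i) (m j) < e" by blast
  qed
  then obtain p where p: "m \<longlonglongrightarrow> p"
    using Cauchy_convergent convergent_def by blast
  have "p \<in> M" using \<open>closed M\<close> m(1) p closed_sequentially by blast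
  have "(\<lambda>n. d + 1 / Suc n) \<longlonglongrightarrow> d + 0"
    by (intro tendsto_intros LIMSEQ_Suc[OF lim_1_over_n])
  moreover have "(\<lambda>n. norm (x - m n)) \<longlonglongrightarrow> norm (x - p)"
    using p by (intro tendsto_intros)
  ultimately have "norm (x - p) \<le> d + 0"
    using m(2) less_imp_le by (intro LIMSEQ_le[of _ _ _ "d + 0"]) blast+
  then have "norm (x - p) \<le> norm (x - k)" if "k \<in> M" for k
    using d(2)[OF that] by linarith
  then show thesis
    using that closest_point_subspace_orthogonal[OF sub \<open>p \<in> M\<close>] \<open>p \<in> M\<close> by blast
qed

text \<open>Uniform boundedness principle for the functionals that the vectors of \<open>F\<close>
  represent: by Baire, one of the closed sets \<open>E n\<close> covering the space contains a
  ball.\<close>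

lemma pointwise_bounded_imp_norm_bounded:
  fixes F :: "'a::{real_inner, complete_space} set"
  assumes "\<And>w. \<exists>K. \<forall>f\<in>F. \<bar>inner w f\<bar> \<le> K"
  obtains K where "K \<ge> 0" "\<And>f. f \<in> F \<Longrightarrow> norm f \<le> K"
proof -
  define E where "E n = {w. \<forall>f\<in>F. \<bar>inner w f\<bar> \<le> real n}" for n
  have E_closed: "closed (E n)" for n
  proof -
    have "E n = (\<Inter>f\<in>F. {w. \<bar>inner w f\<bar> \<le> real n})" by (auto simp: E_def)
    then show ?thesis by (auto intro!: closed_INT closed_Collect_le continuous_intros)
  qed
  have "(\<Union>n. E n) = UNIV"
  proof -
    have "\<exists>n. w \<in> E n" for w
    proof -
      obtain K where "\<forall>f\<in>F. \<bar>inner w f\<bar> \<le> K" using assms by blast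
      then have "w \<in> E (nat \<lceil>K\<rceil>)"
        unfolding E_def by (auto intro: order_trans[OF _ real_nat_ceiling_ge])
      then show ?thesis ..
    qed
    then show ?thesis by blast
  qed
  have "\<exists>n. interior (E n) \<noteq> {}"
  proof (rule ccontr)
    assume "\<not> ?thesis"
    then have "euclidean interior_of \<Union> (range E) = {}"
      by (intro Baire_category_alt) (auto simp: completely_metrizable_space_euclidean E_closed)
    then show False using \<open>(\<Union>n. E n) = UNIV\<close> by simp
  qed
  then obtain n w e where "e > 0" and ball: "cball w e \<subseteq> E n"
    by (meson ex_in_conv mem_interior_cball)
  \<comment> \<open>The centre \<open>w\<close> and the boundary point \<open>w + v\<close> in the
    direction of \<open>f\<close> both lie in \<open>E n\<close>; subtracting their pairings with
    \<open>f\<close> gives \<open>e * norm f \<le> 2 * n\<close>.\<close>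
  have "norm f \<le> 2 * real n / e" if "f \<in> F" for f
  proof (cases "f = 0")
    case False
    define v where "v = (e / norm f) *\<^sub>R f"
    have "w \<in> E n" "w + v \<in> E n"
      using ball \<open>e > 0\<close> False by (auto simp: v_def dist_norm subset_iff)
    then have "\<bar>inner w f\<bar> \<le> n" "\<bar>inner (w + v) f\<bar> \<le> n" using that by (auto simp: E_def)
    then have "inner v f \<le> 2 * n" by (auto simp: inner_add_left)
    moreover have "inner v f = e * norm f"
      using False by (simp add: v_def power2_eq_square flip: power2_norm_eq_inner)
    ultimately show ?thesis using \<open>e > 0\<close> by (simp add: field_simps)
  qed (use \<open>e > 0\<close> in simp)
  then show thesis using that[of "2 * real n / e"] \<open>e > 0\<close> by simp
qed

section \<open>Complex inner products and adjoints\<close>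

lemma cinner_add_right: "cinner x (y + z) = cinner x y + cinner x (z :: 'a::complex_inner)"
  by (metis cinner_add_left cinner_commute complex_cnj_add)

lemma cinner_scaleC_right: "cinner x (c *\<^sub>C y) = cnj c * cinner x (y :: 'a::complex_inner)"
  by (metis cinner_commute cinner_scaleC_left complex_cnj_mult)

lemma scaleC_minus_one: "- 1 *\<^sub>C x = - (x :: 'a::complex_vector)"
  using scaleR_scaleC[of "- 1" x] by simp

lemma cinner_minus_left: "cinner (- x) y = - cinner x (y :: 'a::complex_inner)"
  by (metis scaleC_minus_one cinner_scaleC_left mult_minus1)

lemma cinner_minus_right: "cinner x (- y) = - cinner x (y :: 'a::complex_inner)"
  by (metis cinner_commute cinner_minus_left complex_cnj_minus)

lemma cinner_diff_left: "cinner (x - y) z = cinner x z - cinner y (z :: 'a::complex_inner)"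
  by (metis cinner_add_left cinner_minus_left diff_conv_add_uminus)

lemma cinner_diff_right: "cinner x (y - z) = cinner x y - cinner x (z :: 'a::complex_inner)"
  by (metis cinner_add_right cinner_minus_right diff_conv_add_uminus)

lemma cinner_zero_left: "cinner 0 (x :: 'a::complex_inner) = 0"
  using cinner_diff_left[of 0 0 x] by simp

lemmas cinner_simps = cinner_add_left cinner_add_right cinner_diff_left cinner_diff_right
  cinner_minus_left cinner_minus_right cinner_scaleC_left cinner_scaleC_right

lemma scaleC_diff_right: "c *\<^sub>C (x - y) = c *\<^sub>C x - c *\<^sub>C (y :: 'a::complex_vector)"
  by (metis add_diff_cancel_right' diff_add_cancel scaleC_add_right)

lemma norm_scaleC: "norm (c *\<^sub>C x) = cmod c * norm (x :: 'a::complex_inner)"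
proof -
  have "complex_of_real ((norm (c *\<^sub>C x))\<^sup>2) = complex_of_real ((cmod c * norm x)\<^sup>2)"
    by (simp only: power_mult_distrib of_real_mult complex_norm_square[of c]
        cinner_self[of x, symmetric] cinner_self[of "c *\<^sub>C x", symmetric] cinner_simps mult_ac)
  then show ?thesis
    by (simp only: of_real_eq_iff) (simp add: power2_eq_iff_nonneg)
qed

text \<open>Reduces limits and orthogonality for the complex product to the real one: the imaginary
  part of a number is minus the real part of its product with \<open>\<i>\<close>.\<close>

lemma cinner_eq_Complex: "cinner x y = Complex (inner x y) (- inner (\<i> *\<^sub>C x) y)"
  by (simp add: complex_eq_iff inner_eq_Re_cinner cinner_scaleC_left)

lemma tendsto_cinner_right:
  assumes "(f \<longlongrightarrow> y) F"
  shows "((\<lambda>n. cinner x (f n)) \<longlongrightarrow> cinner x y) F"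
  unfolding cinner_eq_Complex using assms by (intro tendsto_intros)

text \<open>The vectors orthogonal to \<open>y - z\<close> form a closed set, so they fill the space
  and include \<open>y - z\<close> itself.\<close>

lemma cinner_right_eq_on_dense:
  fixes y z :: "'a::complex_inner"
  assumes "closure S = UNIV" and eq: "\<And>x. x \<in> S \<Longrightarrow> cinner x y = cinner x z"
  shows "y = z"
proof -
  have "closed {x. inner x (y - z) = 0}"
    by (intro closed_Collect_eq continuous_intros)
  moreover have "S \<subseteq> {x. inner x (y - z) = 0}"
    using eq by (auto simp: inner_eq_Re_cinner cinner_simps)
  ultimately have "closure S \<subseteq> {x. inner x (y - z) = 0}"
    by (rule closure_minimal[rotated])
  then have "inner (y - z) (y - z) = 0" using assms(1) by blast
  then show ?thesis by simp
qed

text \<open>Density leaves at most one candidate for the \<open>THE\<close> in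
  \<open>adjoint_op\<close>.\<close>

lemma adjoint_op_eq_Some_iff:
  assumes "densely_defined T"
  shows "adjoint_op T y = Some z \<longleftrightarrow> (\<forall>x u. T x = Some u \<longrightarrow> cinner u y = cinner x z)"
proof -
  define P where "P z \<longleftrightarrow> (\<forall>x\<in>dom T. cinner (the (T x)) y = cinner x z)" for z
  have unique: "z = z'" if "P z" "P z'" for z z'
    using assms that
    by (intro cinner_right_eq_on_dense[of "dom T"]) (simp_all add: densely_defined_def P_def)
  have "adjoint_op T y = (if \<exists>z. P z then Some (THE z. P z) else None)"
    by (simp add: adjoint_op_def P_def)
  moreover have "(THE z. P z) = z'" if "P z'" for z'
    using that unique by blast
  ultimately have "adjoint_op T y = Some z \<longleftrightarrow> P z"
    by (metis option.distinct(1) option.inject)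
  also have "\<dots> \<longleftrightarrow> (\<forall>x u. T x = Some u \<longrightarrow> cinner u y = cinner x z)"
    unfolding P_def by (metis domD domI option.sel)
  finally show ?thesis .
qed

lemma op_eq_iff: "S = T \<longleftrightarrow> (\<forall>x u. S x = Some u \<longleftrightarrow> T x = Some u)"
  by (metis ext option.exhaust)

lemma resolvent_op_eq_Some_iff:
  assumes "inj_on (T -\<^sub>o scalar_op c) (dom (T -\<^sub>o scalar_op c))"
  shows "resolvent_op T c w = Some y \<longleftrightarrow> (\<exists>z. T y = Some z \<and> w = z - c *\<^sub>C y)"
proof -
  have S: "(T -\<^sub>o scalar_op c) y = Some w \<longleftrightarrow> (\<exists>z. T y = Some z \<and> w = z - c *\<^sub>C y)" for y w
    by (auto simp: op_minus_def scalar_op_def)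
  have "(THE x. (T -\<^sub>o scalar_op c) x = Some w) = y'" if "(T -\<^sub>o scalar_op c) y' = Some w" for y'
    using that assms by (intro the_equality) (auto simp: inj_on_def dom_def)
  then have "resolvent_op T c w = Some y \<longleftrightarrow> (T -\<^sub>o scalar_op c) y = Some w"
    by (auto simp: resolvent_op_def op_inverse_def ran_def)
  then show ?thesis using S by simp
qed

lemma block_op_eq_Some_iff:
  "block_op A B C D (x, y) = Some (f, g) \<longleftrightarrow>
    (\<exists>a b c d. A x = Some a \<and> B y = Some b \<and> C x = Some c \<and> D y = Some d \<and> f = a + b \<and> g = c + d)"
  by (auto simp: block_op_def)


lemma self_adjoint_iff:
  assumes "densely_defined T"
  shows "self_adjoint T \<longleftrightarrow>
    (\<forall>y z. T y = Some z \<longleftrightarrow> (\<forall>x u. T x = Some u \<longrightarrow> cinner u y = cinner x z))"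
  unfolding self_adjoint_def op_eq_iff[of T] adjoint_op_eq_Some_iff[OF assms] using assms by blast

section \<open>Linear operators, limits and norm estimates\<close>

lemma linear_op_add:
  "linear_op T \<Longrightarrow> T x = Some u \<Longrightarrow> T y = Some v \<Longrightarrow> T (x + y) = Some (u + v)"
  by (simp add: linear_op_def)

lemma linear_op_scaleC: "linear_op T \<Longrightarrow> T x = Some u \<Longrightarrow> T (c *\<^sub>C x) = Some (c *\<^sub>C u)"
  by (simp add: linear_op_def)

lemma linear_op_zero: "linear_op T \<Longrightarrow> T 0 = Some 0"
  by (simp add: linear_op_def)

lemma linear_op_diff:
  "linear_op T \<Longrightarrow> T x = Some u \<Longrightarrow> T y = Some v \<Longrightarrow> T (x - y) = Some (u - v)"
  using linear_op_add[of T x u "- 1 *\<^sub>C y" "- 1 *\<^sub>C v"] linear_op_scaleC[of T y v "- 1"]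
  by (simp add: scaleC_minus_one)

lemma tendsto_scaleC:
  fixes y :: "'a::complex_inner"
  assumes "(f \<longlongrightarrow> y) F"
  shows "((\<lambda>n. c *\<^sub>C f n) \<longlongrightarrow> c *\<^sub>C y) F"
proof -
  have "((\<lambda>n. cmod c * norm (f n - y)) \<longlongrightarrow> cmod c * norm (y - y)) F"
    using assms by (intro tendsto_intros)
  then have "((\<lambda>n. norm (c *\<^sub>C f n - c *\<^sub>C y)) \<longlongrightarrow> 0) F"
    by (simp add: norm_scaleC flip: scaleC_diff_right)
  then show ?thesis
    by (simp add: tendsto_norm_zero_iff LIM_zero_iff)
qed

text \<open>The right-hand side depends on \<open>c\<close> only through its modulus and real part.
  Replacing \<open>c\<close> by \<open>cnj c\<close> therefore keeps the norm, and for
  \<open>c = \<i>\<close> the cross term vanishes.\<close>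

lemma norm_diff_scaleC_square:
  assumes "Im (cinner z y) = 0"
  shows "(norm (z - c *\<^sub>C y))\<^sup>2 = (norm z)\<^sup>2 + (cmod c * norm y)\<^sup>2 - 2 * Re c * inner z y"
proof -
  have "inner z (c *\<^sub>C y) = Re c * inner z y"
    using assms by (simp add: inner_eq_Re_cinner cinner_scaleC_right)
  then show ?thesis
    unfolding norm_scaleC[symmetric] power2_norm_eq_inner inner_diff_left inner_diff_right
    by (simp add: inner_commute)
qed

lemma Cauchy_dominated:
  fixes x :: "nat \<Rightarrow> 'a::real_normed_vector" and y :: "nat \<Rightarrow> 'b::real_normed_vector"
  assumes "Cauchy x" and le: "\<And>i j. norm (y i - y j) \<le> K * norm (x i - x j)" and "K \<ge> 0"
  shows "Cauchy y"
proof (rule metric_CauchyI)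
  fix e :: real assume "e > 0"
  \<comment> \<open>\<open>K + 1\<close> instead of \<open>K\<close> keeps the divisor positive when
    \<open>K = 0\<close>.\<close>
  then have "e / (K + 1) > 0" using \<open>K \<ge> 0\<close> by simp
  then obtain N where N: "\<forall>i\<ge>N. \<forall>j\<ge>N. dist (x i) (x j) < e / (K + 1)"
    using \<open>Cauchy x\<close> unfolding Cauchy_def by blast
  have "dist (y i) (y j) < e" if "N \<le> i" "N \<le> j" for i j
  proof -
    have "norm (y i - y j) \<le> (K + 1) * norm (x i - x j)"
      using le[of i j] by (simp add: distrib_right add_increasing2)
    also have "\<dots> < e"
      using N that \<open>K \<ge> 0\<close> by (simp add: dist_norm pos_less_divide_eq mult.commute)
    finally show ?thesis by (simp add: dist_norm)
  qed
  then show "\<exists>N. \<forall>i\<ge>N. \<forall>j\<ge>N. dist (y i) (y j) < e" by blast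
qed

lemma diff_diff_scaleC:
  "(z - z') - c *\<^sub>C (y - y') = (z - c *\<^sub>C y) - (z' - c *\<^sub>C (y' :: 'a::complex_vector))"
  by (simp add: scaleC_diff_right)

section \<open>Resolvents of self-adjoint operators\<close>

text \<open>
  The bound makes the range of \<^term>\<open>T -\<^sub>o scalar_op c\<close> closed. A vector orthogonal to the range
  is an eigenvector for \<^term>\<open>cnj c\<close>, and as \<^term>\<open>T\<close> is symmetric, the bound for \<^term>\<open>c\<close> is also
  one for \<^term>\<open>cnj c\<close>.
\<close>

lemma mem_resolvent_setI:
  fixes T :: "'a::chilbert_space \<rightharpoonup> 'a"
  assumes lin: "linear_op T" and "self_adjoint T" and "K > 0"
    and bound: "\<And>y z. T y = Some z \<Longrightarrow> norm y \<le> K * norm (z - c *\<^sub>C y)"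
  shows "c \<in> resolvent_set T"
proof -
  have adj: "T y = Some z \<longleftrightarrow> (\<forall>x u. T x = Some u \<longrightarrow> cinner u y = cinner x z)" for y z
    using \<open>self_adjoint T\<close> self_adjoint_iff unfolding self_adjoint_def by metis
  define M where "M = {z - c *\<^sub>C y |y z. T y = Some z}"
  have MI: "z - c *\<^sub>C y \<in> M" if "T y = Some z" for y z
    using that by (auto simp: M_def)
  have M_scaleC: "d *\<^sub>C w \<in> M" if w: "w \<in> M" for d w
  proof -
    obtain y z where "T y = Some z" "w = z - c *\<^sub>C y" using w by (auto simp: M_def)
    then show ?thesis
      using MI[OF linear_op_scaleC[OF lin, of y z d]]
      by (simp add: scaleC_diff_right scaleC_scaleC mult.commute)
  qed
  have "subspace M"
  proof (rule subspaceI)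
    show "0 \<in> M" using MI[OF linear_op_zero[OF lin]] by (simp add: scaleC_diff_right[of c 0 0, simplified])
    show "r *\<^sub>R w \<in> M" if "w \<in> M" for r w
      using M_scaleC[OF that] by (simp add: scaleR_scaleC)
    show "v + w \<in> M" if vw: "v \<in> M" "w \<in> M" for v w
    proof -
      obtain y z y' z' where "T y = Some z" "v = z - c *\<^sub>C y" "T y' = Some z'" "w = z' - c *\<^sub>C y'"
        using vw unfolding M_def by blast
      then show ?thesis
        using MI[OF linear_op_add[OF lin, of y z y' z']] by (simp add: scaleC_add_right add_diff_add)
    qed
  qed
  \<comment> \<open>For a convergent sequence in \<open>M\<close>, the bound makes the preimages
    \<open>y n\<close> Cauchy. The relation with all \<open>T x = Some u\<close> passes to the
    limit, and since \<open>T\<close> is its own adjoint, this puts \<open>y'\<close> into its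
    domain.\<close>
  moreover have "closed M"
    unfolding closed_sequential_limits
  proof (intro allI impI, elim conjE)
    fix w l assume "\<forall>n. w n \<in> M" and w: "w \<longlonglongrightarrow> l"
    then have "\<forall>n. \<exists>y z. T y = Some z \<and> w n = z - c *\<^sub>C y"
      unfolding M_def by blast
    then obtain y z where yz: "\<And>n. T (y n) = Some (z n)" "\<And>n. w n = z n - c *\<^sub>C y n" by metis
    have le: "norm (y i - y j) \<le> K * norm (w i - w j)" for i j
      using bound[OF linear_op_diff[OF lin yz(1) yz(1), of i j]]
      by (simp only: diff_diff_scaleC yz(2)[symmetric])
    have "Cauchy y"
      using LIMSEQ_imp_Cauchy[OF w] le \<open>K > 0\<close> by (intro Cauchy_dominated[of w y K]) auto
    then obtain y' where y': "y \<longlonglongrightarrow> y'" using Cauchy_convergent convergent_def by blast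
    have "(\<lambda>n. w n + c *\<^sub>C y n) \<longlonglongrightarrow> l + c *\<^sub>C y'"
      by (intro tendsto_intros tendsto_scaleC w y')
    then have z: "z \<longlonglongrightarrow> l + c *\<^sub>C y'" by (simp add: yz(2))
    have "cinner u y' = cinner x (l + c *\<^sub>C y')" if "T x = Some u" for x u
    proof (rule LIMSEQ_unique)
      show "(\<lambda>n. cinner u (y n)) \<longlonglongrightarrow> cinner u y'" using y' by (rule tendsto_cinner_right)
      have "cinner u (y n) = cinner x (z n)" for n using adj that yz(1) by blast
      then show "(\<lambda>n. cinner u (y n)) \<longlonglongrightarrow> cinner x (l + c *\<^sub>C y')"
        using tendsto_cinner_right[OF z] by simp
    qed
    then have "T y' = Some (l + c *\<^sub>C y')" using adj by blast
    then show "l \<in> M" using MI[of y' "l + c *\<^sub>C y'"] by simp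
  qed
  ultimately have proj: "\<exists>p\<in>M. \<forall>k\<in>M. inner (w - p) k = 0" for w
    using orthogonal_projection_exists by metis
  have "w \<in> M" for w
  proof -
    obtain p where p: "p \<in> M" "\<forall>k\<in>M. inner (w - p) k = 0" using proj by blast
    define q where "q = w - p"
    \<comment> \<open>The projection is orthogonal only for the real product; invariance of
      \<open>M\<close> under \<open>\<i>\<close> upgrades this to the complex one.\<close>
    have perp: "cinner k q = 0" if "k \<in> M" for k
      using p(2) that M_scaleC[OF that, of "\<i>"]
      by (simp add: cinner_eq_Complex q_def inner_commute zero_complex.code)
    have "cinner u q = cinner x (cnj c *\<^sub>C q)" if "T x = Some u" for x u
      using perp[OF MI[OF that]] by (simp add: cinner_simps)
    then have Tq: "T q = Some (cnj c *\<^sub>C q)" using adj by blast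
    then have "cinner (cnj c *\<^sub>C q) q = cinner q (cnj c *\<^sub>C q)" using adj by blast
    then have "Im (cinner (cnj c *\<^sub>C q) q) = 0"
      by (metis cinner_commute cnj.sel(2) equation_minus_iff neg_equal_zero)
    \<comment> \<open>The right-hand side is zero, so the bound at \<open>c\<close>, applied to the
      eigenvector \<open>q\<close>, gives \<open>q = 0\<close>.\<close>
    then have "(norm (cnj c *\<^sub>C q - c *\<^sub>C q))\<^sup>2 = (norm (cnj c *\<^sub>C q - cnj c *\<^sub>C q))\<^sup>2"
      by (simp only: norm_diff_scaleC_square) simp
    then have "q = 0" using bound[OF Tq] by simp
    then show ?thesis using p(1) by (simp add: q_def)
  qed
  then have M_UNIV: "\<exists>y z. T y = Some z \<and> w = z - c *\<^sub>C y" for w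
    unfolding M_def by blast
  have S: "(T -\<^sub>o scalar_op c) y = Some w \<longleftrightarrow> (\<exists>z. T y = Some z \<and> w = z - c *\<^sub>C y)" for y w
    by (auto simp: op_minus_def scalar_op_def)
  have inj: "y = y'" if "T y = Some z" "T y' = Some z'" "z - c *\<^sub>C y = z' - c *\<^sub>C y'" for y y' z z'
    using bound[OF linear_op_diff[OF lin that(1,2)]] that(3)
    by (simp add: diff_diff_scaleC)
  have inj_on: "inj_on (T -\<^sub>o scalar_op c) (dom (T -\<^sub>o scalar_op c))"
    by (rule inj_onI) (metis S domD inj)
  define R where "R w = the (resolvent_op T c w)" for w
  have R: "\<exists>z. T (R w) = Some z \<and> w = z - c *\<^sub>C R w" for w
    using M_UNIV[of w] resolvent_op_eq_Some_iff[OF inj_on] unfolding R_def by (metis option.sel)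
  have R_eq: "R (z - c *\<^sub>C y) = y" if "T y = Some z" for y z
    using R inj that by metis
  \<comment> \<open>\<open>bounded_linear\<close> is real linearity, hence the real scalars.\<close>
  have R_scaleR: "R (r *\<^sub>R w) = r *\<^sub>R R w" for r w
  proof -
    obtain z where z: "T (R w) = Some z" "w = z - c *\<^sub>C R w" using R by blast
    have "r *\<^sub>R w = of_real r *\<^sub>C z - c *\<^sub>C of_real r *\<^sub>C R w"
      by (subst z(2)) (simp add: scaleR_scaleC scaleC_diff_right scaleC_scaleC mult.commute)
    then show ?thesis
      using R_eq[OF linear_op_scaleC[OF lin z(1)]] by (simp add: scaleR_scaleC)
  qed
  have R_add: "R (v + w) = R v + R w" for v w
  proof -
    obtain z z' where z: "T (R v) = Some z" "v = z - c *\<^sub>C R v"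
      and z': "T (R w) = Some z'" "w = z' - c *\<^sub>C R w" using R by metis
    have "v + w = (z + z') - c *\<^sub>C (R v + R w)"
      by (subst z(2), subst z'(2)) (simp add: scaleC_add_right)
    then show ?thesis using R_eq[OF linear_op_add[OF lin z(1) z'(1)]] by simp
  qed
  have "bounded_linear R"
    using R bound by (intro bounded_linear_intro[of R K] R_add R_scaleR) (metis mult.commute)
  moreover have "ran (T -\<^sub>o scalar_op c) = UNIV"
    using M_UNIV S by (auto simp: ran_def)
  ultimately show ?thesis
    using inj_on by (simp add: resolvent_set_def flip: R_def)
qed

lemma cinner_self_adjoint:
  assumes "self_adjoint T" "T x = Some u" "T y = Some v"
  shows "cinner u y = cinner x v"
  using assms self_adjoint_iff unfolding self_adjoint_def by metis

lemma self_adjoint_Im_zero: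
  assumes "self_adjoint T" "T x = Some u"
  shows "Im (cinner u x) = 0"
  using cinner_self_adjoint[OF assms(1,2,2)]
  by (metis cinner_commute cnj.sel(2) equation_minus_iff neg_equal_zero)

text \<open>For symmetric \<open>T\<close> the squared norm of \<open>z - \<i> *\<^sub>C y\<close>
  is the sum of those of \<open>z\<close> and \<open>y\<close>, so the bound holds with constant 1.
  This makes the resolvent set nonempty.\<close>

lemma imaginary_unit_in_resolvent_set:
  fixes T :: "'a::chilbert_space \<rightharpoonup> 'a"
  assumes "linear_op T" "self_adjoint T"
  shows "\<i> \<in> resolvent_set T"
proof (rule mem_resolvent_setI[OF assms, of 1])
  fix y z assume yz: "T y = Some z"
  have "(norm y)\<^sup>2 \<le> (norm (z - \<i> *\<^sub>C y))\<^sup>2"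
    by (simp add: norm_diff_scaleC_square[OF self_adjoint_Im_zero[OF assms(2) yz]])
  then show "norm y \<le> 1 * norm (z - \<i> *\<^sub>C y)"
    using power2_le_imp_le[of "norm y"] by simp
qed simp

lemma resolvent_set_op_eq_Some_iff:
  assumes "c \<in> resolvent_set T"
  shows "resolvent_op T c w = Some y \<longleftrightarrow> (\<exists>z. T y = Some z \<and> w = z - c *\<^sub>C y)"
  using assms by (intro resolvent_op_eq_Some_iff) (simp add: resolvent_set_def)

lemma resolvent_op_SomeE:
  assumes "c \<in> resolvent_set T" "resolvent_op T c w = Some y"
  obtains z where "T y = Some z" "w = z - c *\<^sub>C y"
  using assms(2) that unfolding resolvent_set_op_eq_Some_iff[OF assms(1)] by auto

lemma resolvent_op_total:
  assumes "c \<in> resolvent_set T"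
  obtains y where "resolvent_op T c w = Some y"
proof -
  have "w \<in> ran (T -\<^sub>o scalar_op c)" using assms by (simp add: resolvent_set_def)
  then show thesis using that by (simp add: resolvent_op_def op_inverse_def)
qed

text \<open>Boundedness of the resolvent at \<open>c\<close> is a lower bound for
  \<open>T - c\<close>, and by symmetry of \<open>T\<close> the same bound holds at
  \<open>cnj c\<close>.\<close>

lemma cnj_mem_resolvent_set:
  fixes T :: "'a::chilbert_space \<rightharpoonup> 'a"
  assumes "linear_op T" "self_adjoint T" "c \<in> resolvent_set T"
  shows "cnj c \<in> resolvent_set T"
proof -
  have "bounded_linear (\<lambda>y. the (resolvent_op T c y))"
    using assms(3) by (simp add: resolvent_set_def)
  then obtain K where K: "K > 0" "\<And>w. norm (the (resolvent_op T c w)) \<le> norm w * K"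
    using bounded_linear.pos_bounded by blast
  show ?thesis
  proof (rule mem_resolvent_setI[OF assms(1,2) K(1)])
    fix y z assume yz: "T y = Some z"
    then have "resolvent_op T c (z - c *\<^sub>C y) = Some y"
      using resolvent_set_op_eq_Some_iff[OF assms(3)] by blast
    then have "norm y \<le> K * norm (z - c *\<^sub>C y)"
      using K(2)[of "z - c *\<^sub>C y"] by (simp add: mult.commute)
    moreover have "(norm (z - c *\<^sub>C y))\<^sup>2 = (norm (z - cnj c *\<^sub>C y))\<^sup>2"
      by (simp add: norm_diff_scaleC_square[OF self_adjoint_Im_zero[OF assms(2) yz]])
    ultimately show "norm y \<le> K * norm (z - cnj c *\<^sub>C y)"
      by (simp add: power2_eq_iff_nonneg)
  qed
qed

text \<open>The resolvents at \<open>c\<close> and \<open>cnj c\<close> are adjoint to each other: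
  after substituting \<open>w\<close> and \<open>w'\<close>, symmetry of \<open>T\<close> makes both
  sides \<open>cinner y z' - c * cinner y y'\<close>.\<close>

lemma cinner_resolvent_op:
  assumes "self_adjoint T" "c \<in> resolvent_set T" "cnj c \<in> resolvent_set T"
    and "resolvent_op T c w = Some y" "resolvent_op T (cnj c) w' = Some y'"
  shows "cinner y w' = cinner w y'"
proof -
  obtain z z' where "T y = Some z" "w = z - c *\<^sub>C y" "T y' = Some z'" "w' = z' - cnj c *\<^sub>C y'"
    using assms by (auto simp: resolvent_set_op_eq_Some_iff)
  then show ?thesis
    using cinner_self_adjoint[OF assms(1), of y z y' z'] by (simp add: cinner_simps)
qed

section \<open>Self-adjointness of block operators\<close>

text \<open>The setting of (a), with inclusions in adjoints unfolded to identities of inner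
  products. Part (b) is the instance with the two spaces exchanged.\<close>

locale symmetric_block =
  fixes A :: "'a::chilbert_space \<rightharpoonup> 'a" and B :: "'b::chilbert_space \<rightharpoonup> 'a"
    and C :: "'a \<rightharpoonup> 'b" and D :: "'b \<rightharpoonup> 'b"
  assumes linear_A: "linear_op A" and linear_B: "linear_op B"
    and linear_C: "linear_op C" and linear_D: "linear_op D"
    and A_symmetric: "A x = Some u \<Longrightarrow> A x' = Some u' \<Longrightarrow> cinner u x' = cinner x u'"
    and BC_adjoint: "B y = Some b \<Longrightarrow> C x = Some c \<Longrightarrow> cinner b x = cinner y c"
    and D_self_adjoint: "self_adjoint D"
    and dom_D_subset: "dom D \<subseteq> dom B"
    and AC_dense: "closure (dom A \<inter> dom C) = UNIV"
    and C_dense: "closure (dom C) = UNIV"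
begin

text \<open>The Schur complement of the block operator with respect to \<open>D - l\<close>.\<close>

abbreviation schur :: "complex \<Rightarrow> ('a \<rightharpoonup> 'a)" where
  "schur l \<equiv> A -\<^sub>o (B \<circ>\<^sub>m resolvent_op D l \<circ>\<^sub>m C)"

lemma schur_eq_Some_iff:
  "schur l x = Some w \<longleftrightarrow>
    (\<exists>a c y b. A x = Some a \<and> C x = Some c \<and> resolvent_op D l c = Some y \<and> B y = Some b \<and> w = a - b)"
  by (auto simp: op_minus_def map_comp_Some_iff dom_def)

text \<open>The resolvent maps into \<open>dom D\<close>, which lies in \<open>dom B\<close>. Hence
  the correction term does not shrink the domain of the Schur complement.\<close>

lemma BR_total:
  assumes "l \<in> resolvent_set D"
  obtains y b where "resolvent_op D l w = Some y" "B y = Some b"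
proof -
  obtain y where y: "resolvent_op D l w = Some y"
    using resolvent_op_total[OF assms] .
  then have "y \<in> dom D" by (auto simp: resolvent_set_op_eq_Some_iff[OF assms])
  then show thesis using that y dom_D_subset by blast
qed

lemma dom_schur:
  assumes "l \<in> resolvent_set D"
  shows "dom (schur l) = dom A \<inter> dom C"
proof -
  have "\<exists>w. schur l x = Some w" if "A x = Some a" "C x = Some c" for x a c
  proof -
    obtain y b where "resolvent_op D l c = Some y" "B y = Some b" using BR_total[OF assms] .
    then show ?thesis using that unfolding schur_eq_Some_iff by blast
  qed
  moreover have "\<exists>a c. A x = Some a \<and> C x = Some c" if "schur l x = Some w" for x w
    using that unfolding schur_eq_Some_iff by blast
  ultimately show ?thesis by (auto simp: dom_def)
qed

lemma schur_densely_defined: "l \<in> resolvent_set D \<Longrightarrow> densely_defined (schur l)"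
  by (simp add: densely_defined_def dom_schur AC_dense)

lemma block_densely_defined: "densely_defined (block_op A B C D)"
proof -
  have "dom (block_op A B C D) = (dom A \<inter> dom C) \<times> dom D"
    using dom_D_subset by (auto simp: block_op_def dom_def split: if_splits)
  then show ?thesis
    using AC_dense D_self_adjoint by (simp add: densely_defined_def self_adjoint_def closure_Times)
qed

text \<open>This is the inclusion of \<open>R'C\<close> in the adjoint of \<open>BR\<close>: move
  \<open>B\<close> across by \<open>BC_adjoint\<close>, then the resolvent.\<close>

lemma cinner_BR:
  assumes "l \<in> resolvent_set D"
    and "resolvent_op D l w = Some y" "B y = Some b" "C x = Some c" "resolvent_op D (cnj l) c = Some y'"
  shows "cinner b x = cinner w y'"
  using BC_adjoint[OF assms(3,4)] assms D_self_adjoint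
    cinner_resolvent_op cnj_mem_resolvent_set linear_D by metis

lemma block_op_symmetric:
  assumes "block_op A B C D p = Some q" "block_op A B C D p' = Some q'"
  shows "cinner q p' = cinner p q'"
proof -
  obtain x y f g x' y' f' g' where p: "p = (x, y)" "q = (f, g)" "p' = (x', y')" "q' = (f', g')"
    by (metis surj_pair)
  obtain a b c d a' b' c' d' where
    *: "A x = Some a" "B y = Some b" "C x = Some c" "D y = Some d" "f = a + b" "g = c + d"
    "A x' = Some a'" "B y' = Some b'" "C x' = Some c'" "D y' = Some d'" "f' = a' + b'" "g' = c' + d'"
    using assms unfolding p block_op_eq_Some_iff by blast
  have "cinner x b' = cinner c y'"
    using BC_adjoint[OF *(8) *(3)] by (metis cinner_commute)
  then show ?thesis
    using A_symmetric[OF *(1) *(7)] BC_adjoint[OF *(2) *(9)]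
      cinner_self_adjoint[OF D_self_adjoint *(4) *(10)]
    by (simp add: p * cinner_prod_def cinner_simps)
qed

section \<open>From the Schur complement to the block operator\<close>

lemma self_adjoint_blockI:
  assumes l: "l \<in> resolvent_set D" and S: "adjoint_op (schur l) = schur (cnj l)"
  shows "self_adjoint (block_op A B C D)"
  unfolding self_adjoint_iff[OF block_densely_defined]
proof (intro allI iffI impI)
  fix p q assume adj: "\<forall>s t. block_op A B C D s = Some t \<longrightarrow> cinner t p = cinner s q"
  obtain u v f g where pq: "p = (u, v)" "q = (f, g)" by (metis surj_pair)
  have l': "cnj l \<in> resolvent_set D"
    using l linear_D D_self_adjoint by (simp add: cnj_mem_resolvent_set)
  \<comment> \<open>Testing with \<open>(x, 0)\<close>, and below with \<open>(0, y)\<close>, splits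
    the adjoint relation into two equations.\<close>
  have first: "cinner a u + cinner c v = cinner x f" if "A x = Some a" "C x = Some c" for x a c
  proof -
    have "block_op A B C D (x, 0) = Some (a, c)"
      using that linear_op_zero[OF linear_B] linear_op_zero[OF linear_D]
      by (simp add: block_op_eq_Some_iff)
    then have "cinner (a, c) p = cinner (x, 0) q" using adj by blast
    then show ?thesis
      by (simp add: pq cinner_prod_def cinner_zero_left)
  qed
  have second: "cinner b u + cinner d v = cinner y g" if "B y = Some b" "D y = Some d" for y b d
  proof -
    have "block_op A B C D (0, y) = Some (b, d)"
      using that linear_op_zero[OF linear_A] linear_op_zero[OF linear_C]
      by (simp add: block_op_eq_Some_iff)
    then have "cinner (b, d) p = cinner (0, y) q" using adj by blast
    then show ?thesis
      by (simp add: pq cinner_prod_def cinner_zero_left)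
  qed
  obtain r e where r: "resolvent_op D (cnj l) (g - cnj l *\<^sub>C v) = Some r" and e: "B r = Some e"
    using BR_total[OF l'] .
  obtain z where z: "D r = Some z" "g - cnj l *\<^sub>C v = z - cnj l *\<^sub>C r"
    by (rule resolvent_op_SomeE[OF l' r])
  \<comment> \<open>This says that the adjoint of \<open>BR\<close> maps \<open>u\<close> to
    \<open>r - v\<close>.\<close>
  have BR_u: "cinner b u + cinner w v = cinner w r"
    if yb: "resolvent_op D l w = Some y" "B y = Some b" for w y b
  proof -
    obtain d where d: "D y = Some d" "w = d - l *\<^sub>C y"
      by (rule resolvent_op_SomeE[OF l yb(1)])
    have "cinner b u + cinner w v = cinner y (g - cnj l *\<^sub>C v)"
      using second[OF yb(2) d(1)] by (simp add: d(2) cinner_simps)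
    then show ?thesis
      using cinner_resolvent_op[OF D_self_adjoint l l' yb(1) r] by simp
  qed
  \<comment> \<open>The terms in \<open>v\<close> and \<open>r\<close> cancel between
    \<open>first\<close> and \<open>BR_u\<close>, so \<open>u\<close> is in the domain of the
    adjoint Schur complement; the hypothesis then puts it into
    \<open>dom A \<inter> dom C\<close>.\<close>
  have "cinner s u = cinner x (f - e)" if "schur l x = Some s" for x s
  proof -
    obtain a c y b where *: "A x = Some a" "C x = Some c" "resolvent_op D l c = Some y"
      "B y = Some b" "s = a - b"
      using \<open>schur l x = Some s\<close> unfolding schur_eq_Some_iff by blast
    have "cinner x e = cinner c r"
      using BC_adjoint[OF e *(2)] by (metis cinner_commute)
    then show ?thesis
      using first[OF *(1,2), THEN add_implies_diff] BR_u[OF *(3,4), THEN add_implies_diff]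
      by (simp add: *(5) cinner_simps)
  qed
  then have "adjoint_op (schur l) u = Some (f - e)"
    using adjoint_op_eq_Some_iff[OF schur_densely_defined[OF l]] by blast
  then obtain a c y b where *: "A u = Some a" "C u = Some c" "resolvent_op D (cnj l) c = Some y"
    "B y = Some b" "f - e = a - b"
    unfolding S schur_eq_Some_iff by blast
  obtain d where d: "D y = Some d" "c = d - cnj l *\<^sub>C y"
    by (rule resolvent_op_SomeE[OF l' *(3)])
  \<comment> \<open>The adjoint of \<open>BR\<close> sends \<open>u\<close> to \<open>r - v\<close>
    by \<open>BR_u\<close> and to \<open>y\<close> by \<open>cinner_BR\<close>. Comparing them
    exhibits \<open>v\<close> as a difference of elements of \<open>dom D\<close>.\<close>
  have "cinner w v = cinner w (r - y)" for w
  proof -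
    obtain y' b' where "resolvent_op D l w = Some y'" "B y' = Some b'"
      using BR_total[OF l] .
    then have "cinner w y + cinner w v = cinner w r"
      using BR_u cinner_BR[OF l _ _ *(2,3)] by metis
    then show ?thesis
      by (simp add: cinner_simps algebra_simps)
  qed
  then have v: "v = r - y"
    by (rule cinner_right_eq_on_dense[OF closure_UNIV])
  have "D v = Some (z - d)" "B v = Some (e - b)"
    unfolding v by (rule linear_op_diff[OF linear_D z(1) d(1)], rule linear_op_diff[OF linear_B e *(4)])
  moreover have "f = a + (e - b)" using *(5) by (simp add: algebra_simps)
  moreover have "g = c + (z - d)"
    using z(2) unfolding d(2) v diff_eq_eq scaleC_diff_right by (simp add: algebra_simps)
  ultimately show "block_op A B C D p = Some q"
    using *(1,2) by (simp add: pq block_op_eq_Some_iff)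
qed (use block_op_symmetric in blast)

section \<open>From the block operator to the Schur complement\<close>

text \<open>
  In the proof, \<open>F\<close> consists of the vectors \<open>R'Cx / norm x\<close>: it is pointwise bounded, because pairing
  such a vector with \<open>w\<close> is pairing \<open>x / norm x\<close> with \<open>BRw\<close>. Hence \<open>R'C\<close> is bounded on its dense domain.
\<close>

lemma BR_adjoint_total:
  assumes l: "l \<in> resolvent_set D"
  obtains v where "\<And>w y b. resolvent_op D l w = Some y \<Longrightarrow> B y = Some b \<Longrightarrow> cinner b u = cinner w v"
proof -
  have l': "cnj l \<in> resolvent_set D"
    using l linear_D D_self_adjoint by (simp add: cnj_mem_resolvent_set)
  \<comment> \<open>Since \<open>1 / 0 = 0\<close>, the case \<open>x = 0\<close> contributes only
    the zero vector; \<open>bound\<close> treats it separately.\<close>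
  define F where "F = {(1 / norm x) *\<^sub>R y |x c y. C x = Some c \<and> resolvent_op D (cnj l) c = Some y}"
  have "\<exists>K. \<forall>f\<in>F. \<bar>inner w f\<bar> \<le> K" for w
  proof -
    obtain y b where yb: "resolvent_op D l w = Some y" "B y = Some b" using BR_total[OF l] .
    have "\<bar>inner w ((1 / norm x) *\<^sub>R y')\<bar> \<le> norm b"
      if "C x = Some c" "resolvent_op D (cnj l) c = Some y'" for x c y'
    proof (cases "x = 0")
      case False
      have "inner w y' = inner b x"
        using cinner_BR[OF l yb that] by (simp add: inner_eq_Re_cinner)
      then show ?thesis
        using Cauchy_Schwarz_ineq2[of b x] False by (simp add: abs_divide pos_divide_le_eq)
    qed simp
    then show ?thesis unfolding F_def by blast
  qed
  then obtain K where K: "K \<ge> 0" "\<And>f. f \<in> F \<Longrightarrow> norm f \<le> K"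
    using pointwise_bounded_imp_norm_bounded by blast
  have bound: "norm y \<le> K * norm x"
    if "C x = Some c" "resolvent_op D (cnj l) c = Some y" for x c y
  proof (cases "x = 0")
    \<comment> \<open>Taking \<open>w = y\<close> in \<open>cinner_BR\<close> gives
      \<open>inner y y = inner b 0\<close>, hence \<open>y = 0\<close>.\<close>
    case True
    obtain y' b where "resolvent_op D l y = Some y'" "B y' = Some b" using BR_total[OF l] .
    then have "cinner b x = cinner y y" using cinner_BR[OF l _ _ that] by blast
    then have "inner b x = inner y y" by (simp add: inner_eq_Re_cinner)
    then show ?thesis using True by simp
  next
    case False
    have "norm ((1 / norm x) *\<^sub>R y) \<le> K"
      using that by (intro K(2)) (auto simp: F_def)
    then show ?thesis using False by (simp add: field_simps)
  qed
  \<comment> \<open>The bounded operator \<open>R'C\<close> is extended to \<open>u\<close> along a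
    sequence in \<open>dom C\<close>; the limit is the required \<open>v\<close>.\<close>
  have "u \<in> closure (dom C)" using C_dense by simp
  then obtain x where x: "\<And>n. x n \<in> dom C" "x \<longlonglongrightarrow> u"
    unfolding closure_sequential by blast
  have "\<forall>n. \<exists>c y. C (x n) = Some c \<and> resolvent_op D (cnj l) c = Some y"
    using x(1) resolvent_op_total[OF l'] by (metis domD)
  then obtain c y where cy: "\<And>n. C (x n) = Some (c n)" "\<And>n. resolvent_op D (cnj l) (c n) = Some (y n)"
    by metis
  have "norm (y i - y j) \<le> K * norm (x i - x j)" for i j
  proof (rule bound)
    show "C (x i - x j) = Some (c i - c j)"
      using linear_op_diff[OF linear_C] cy(1) by blast
    obtain d where "\<And>n. D (y n) = Some (d n)" "\<And>n. c n = d n - cnj l *\<^sub>C y n"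
      using cy(2) unfolding resolvent_set_op_eq_Some_iff[OF l'] by metis
    then show "resolvent_op D (cnj l) (c i - c j) = Some (y i - y j)"
      unfolding resolvent_set_op_eq_Some_iff[OF l'] using linear_op_diff[OF linear_D]
      by (metis diff_diff_scaleC)
  qed
  then have "Cauchy y"
    using LIMSEQ_imp_Cauchy[OF x(2)] K(1) by (intro Cauchy_dominated[of x y K]) auto
  then obtain v where v: "y \<longlonglongrightarrow> v" using Cauchy_convergent convergent_def by blast
  show thesis
  proof (rule that)
    fix w y' b assume yb: "resolvent_op D l w = Some y'" "B y' = Some b"
    have "cinner b (x n) = cinner w (y n)" for n
      using cinner_BR[OF l yb cy(1) cy(2)] .
    then show "cinner b u = cinner w v"
      using tendsto_cinner_right[OF x(2), of b] tendsto_cinner_right[OF v, of w]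
      by (simp add: LIMSEQ_unique)
  qed
qed

text \<open>Symmetry of \<open>A\<close> matches the main terms, and both correction terms
  \<open>cinner b u\<close> and \<open>cinner x b'\<close> equal \<open>cinner c y'\<close>.\<close>

lemma schur_adjoint_subset:
  assumes l: "l \<in> resolvent_set D" and "schur l x = Some s" "schur (cnj l) u = Some h"
  shows "cinner s u = cinner x h"
proof -
  obtain a c y b where *: "A x = Some a" "C x = Some c" "resolvent_op D l c = Some y"
    "B y = Some b" "s = a - b"
    using assms(2) unfolding schur_eq_Some_iff by blast
  obtain a' c' y' b' where **: "A u = Some a'" "C u = Some c'" "resolvent_op D (cnj l) c' = Some y'"
    "B y' = Some b'" "h = a' - b'"
    using assms(3) unfolding schur_eq_Some_iff by blast
  have "cinner x b' = cinner c y'"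
    using BC_adjoint[OF **(4) *(2)] by (metis cinner_commute)
  then show ?thesis
    using A_symmetric[OF *(1) **(1)] cinner_BR[OF l *(3,4) **(2,3)]
    by (simp add: *(5) **(5) cinner_simps)
qed

lemma adjoint_schur:
  assumes l: "l \<in> resolvent_set D" and sa: "self_adjoint (block_op A B C D)"
  shows "adjoint_op (schur l) = schur (cnj l)"
  unfolding op_eq_iff[of "adjoint_op _"] adjoint_op_eq_Some_iff[OF schur_densely_defined[OF l]]
proof (intro allI iffI impI)
  have l': "cnj l \<in> resolvent_set D"
    using l linear_D D_self_adjoint by (simp add: cnj_mem_resolvent_set)
  fix u h assume adj: "\<forall>x s. schur l x = Some s \<longrightarrow> cinner s u = cinner x h"
  obtain v where v: "\<And>w y b. resolvent_op D l w = Some y \<Longrightarrow> B y = Some b \<Longrightarrow> cinner b u = cinner w v"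
    using BR_adjoint_total[OF l] by blast
  \<comment> \<open>The sign of \<open>- v\<close> makes the contributions \<open>cinner c v\<close>
    and \<open>cinner d v\<close> cancel; what remains of the second component is
    \<open>- l * cinner y v\<close>.\<close>
  have "cinner t (u, - v) = cinner p (h, - cnj l *\<^sub>C v)" if pt: "block_op A B C D p = Some t" for p t
  proof -
    obtain x y where p: "p = (x, y)" by (cases p)
    obtain f g where t: "t = (f, g)" by (cases t)
    obtain a b c d where *: "A x = Some a" "B y = Some b" "C x = Some c" "D y = Some d"
      "f = a + b" "g = c + d"
      using pt unfolding p t block_op_eq_Some_iff by blast
    have "resolvent_op D l (d - l *\<^sub>C y) = Some y"
      by (simp add: resolvent_set_op_eq_Some_iff[OF l] *(4))
    then have b: "cinner b u = cinner (d - l *\<^sub>C y) v" using v *(2) by blast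
    obtain y' b' where b': "resolvent_op D l c = Some y'" "B y' = Some b'" using BR_total[OF l] .
    then have "schur l x = Some (a - b')"
      unfolding schur_eq_Some_iff using *(1,3) by blast
    then have "cinner (a - b') u = cinner x h" using adj by blast
    moreover have "cinner b' u = cinner c v" using v b' by blast
    ultimately show ?thesis
      using b by (simp add: p t *(5,6) cinner_prod_def cinner_simps algebra_simps)
  qed
  then have "block_op A B C D (u, - v) = Some (h, - cnj l *\<^sub>C v)"
    using sa unfolding self_adjoint_iff[OF block_densely_defined] by blast
  \<comment> \<open>Self-adjointness is used only for membership in the domain; the value is
    identified with \<open>h\<close> by testing on the dense set
    \<open>dom A \<inter> dom C\<close>.\<close>
  then have "u \<in> dom (schur (cnj l))"
    unfolding dom_schur[OF l'] block_op_eq_Some_iff by blast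
  from domD[OF this] obtain h' where h': "schur (cnj l) u = Some h'" ..
  have "cinner x h = cinner x h'" if "x \<in> dom A \<inter> dom C" for x
  proof -
    have "x \<in> dom (schur l)" using that by (simp add: dom_schur[OF l])
    from domD[OF this] obtain s where s: "schur l x = Some s" ..
    then have "cinner s u = cinner x h" using adj by blast
    then show ?thesis using schur_adjoint_subset[OF l s h'] by simp
  qed
  then have "h = h'" using AC_dense by (rule cinner_right_eq_on_dense[rotated])
  then show "schur (cnj l) u = Some h" using h' by simp
qed (use schur_adjoint_subset[OF l] in blast)

text \<open>Equality at one point gives self-adjointness, which gives equality at all points. That
  \<open>\<i>\<close> lies in the resolvent set keeps the universal statement from being
  vacuous.\<close>

theorem self_adjoint_block_iff:
  "(self_adjoint (block_op A B C D) \<longleftrightarrow>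
      (\<exists>l\<in>resolvent_set D. adjoint_op (schur l) = schur (cnj l))) \<and>
   (self_adjoint (block_op A B C D) \<longleftrightarrow>
      (\<forall>l\<in>resolvent_set D. adjoint_op (schur l) = schur (cnj l)))"
  using self_adjoint_blockI adjoint_schur
    imaginary_unit_in_resolvent_set[OF linear_D D_self_adjoint] by blast

end

section \<open>Exchange of the two spaces and conclusion\<close>

lemma block_op_swap:
  fixes A :: "'a::ab_semigroup_add \<rightharpoonup> 'a" and D :: "'b::ab_semigroup_add \<rightharpoonup> 'b"
  shows "block_op D C B A (y, x) = Some (g, f) \<longleftrightarrow> block_op A B C D (x, y) = Some (f, g)"
  unfolding block_op_eq_Some_iff by (metis add.commute)

text \<open>Exchanging coordinates preserves the inner product and carries one block operator to the
  other.\<close>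

lemma self_adjoint_block_swap:
  fixes A :: "'a::chilbert_space \<rightharpoonup> 'a" and D :: "'b::chilbert_space \<rightharpoonup> 'b"
  assumes "densely_defined (block_op A B C D)" "densely_defined (block_op D C B A)"
  shows "self_adjoint (block_op A B C D) \<longleftrightarrow> self_adjoint (block_op D C B A)"
  unfolding self_adjoint_iff[OF assms(1)] self_adjoint_iff[OF assms(2)] split_paired_All
    block_op_swap[of D C B A]
  by (simp only: cinner_prod_def fst_conv snd_conv add.commute) blast

lemma adjoint_subset_cinner:
  assumes "densely_defined C" "B \<subseteq>\<^sub>m adjoint_op C" "B y = Some b" "C x = Some c"
  shows "cinner b x = cinner y c"
proof -
  have "adjoint_op C y = Some b"
    using assms(2,3) by (auto simp: map_le_def dom_def)
  then have "cinner c y = cinner x b"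
    using adjoint_op_eq_Some_iff[OF assms(1)] assms(4) by blast
  then show ?thesis by (metis cinner_commute)
qed



theorem theorem3p1:
  fixes A :: "'a::chilbert_space \<rightharpoonup> 'a" and B :: "'b::chilbert_space \<rightharpoonup> 'a"
    and C :: "'a \<rightharpoonup> 'b" and D :: "'b \<rightharpoonup> 'b"
  assumes "linear_op A" "linear_op B" "linear_op C" "linear_op D"
    and "densely_defined A" "densely_defined B" "densely_defined C" "densely_defined D"
    and "closable_op A" "closable_op B" "closable_op C" "closable_op D"
    and "A \<subseteq>\<^sub>m adjoint_op A" "B \<subseteq>\<^sub>m adjoint_op C" "D \<subseteq>\<^sub>m adjoint_op D"
    and "densely_defined (block_op A B C D)"
  shows
    "(D = adjoint_op D \<and> dom D \<subseteq> dom B \<longrightarrow>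
        (self_adjoint (block_op A B C D) \<longleftrightarrow>
          (\<exists>l\<in>resolvent_set D.
             adjoint_op (A -\<^sub>o (B \<circ>\<^sub>m resolvent_op D l \<circ>\<^sub>m C))
               = A -\<^sub>o (B \<circ>\<^sub>m resolvent_op D (cnj l) \<circ>\<^sub>m C))) \<and>
        (self_adjoint (block_op A B C D) \<longleftrightarrow>
          (\<forall>l\<in>resolvent_set D.
             adjoint_op (A -\<^sub>o (B \<circ>\<^sub>m resolvent_op D l \<circ>\<^sub>m C))
               = A -\<^sub>o (B \<circ>\<^sub>m resolvent_op D (cnj l) \<circ>\<^sub>m C))))
     \<and>
     (A = adjoint_op A \<and> dom A \<subseteq> dom C \<longrightarrow>
        (self_adjoint (block_op A B C D) \<longleftrightarrow>
          (\<exists>l\<in>resolvent_set A.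
             adjoint_op (D -\<^sub>o (C \<circ>\<^sub>m resolvent_op A l \<circ>\<^sub>m B))
               = D -\<^sub>o (C \<circ>\<^sub>m resolvent_op A (cnj l) \<circ>\<^sub>m B))) \<and>
        (self_adjoint (block_op A B C D) \<longleftrightarrow>
          (\<forall>l\<in>resolvent_set A.
             adjoint_op (D -\<^sub>o (C \<circ>\<^sub>m resolvent_op A l \<circ>\<^sub>m B))
               = D -\<^sub>o (C \<circ>\<^sub>m resolvent_op A (cnj l) \<circ>\<^sub>m B))))"
  proof (rule conjI; rule impI)
  have "dom (block_op A B C D) = (dom A \<inter> dom C) \<times> (dom B \<inter> dom D)"
    by (auto simp: block_op_def dom_def split: if_splits)
  \<comment> \<open>A product is dense in the product space only if both factors are dense.\<close>
  then have dense: "closure (dom A \<inter> dom C) = UNIV" "closure (dom D \<inter> dom B) = UNIV"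
    using assms(16) by (auto simp: densely_defined_def closure_Times Int_commute)
  have A_symmetric: "cinner u x' = cinner x u'" if "A x = Some u" "A x' = Some u'" for x u x' u'
    using adjoint_subset_cinner[OF assms(5,13) that] .
  have D_symmetric: "cinner u x' = cinner x u'" if "D x = Some u" "D x' = Some u'" for x u x' u'
    using adjoint_subset_cinner[OF assms(8,15) that] .
  have BC: "cinner b x = cinner y c" if "B y = Some b" "C x = Some c" for x y b c
    using adjoint_subset_cinner[OF assms(7,14) that] .
  \<comment> \<open>The inclusion of \<open>B\<close> in the adjoint of \<open>C\<close> is
    symmetric in the two operators; the exchanged instance needs it in this form.\<close>
  have CB: "cinner c y = cinner x b" if "C x = Some c" "B y = Some b" for x y b c
    using BC[OF that(2,1)] by (metis cinner_commute)
  {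
    assume D: "D = adjoint_op D \<and> dom D \<subseteq> dom B"
    interpret symmetric_block A B C D
    proof
      show "self_adjoint D" using D assms(8) by (simp add: self_adjoint_def)
      show "closure (dom C) = UNIV" using assms(7) by (simp add: densely_defined_def)
      show "dom D \<subseteq> dom B" using D by blast
    qed (fact assms(1-4) dense A_symmetric BC)+
    show
      "(self_adjoint (block_op A B C D) \<longleftrightarrow>
          (\<exists>l\<in>resolvent_set D.
             adjoint_op (A -\<^sub>o (B \<circ>\<^sub>m resolvent_op D l \<circ>\<^sub>m C))
               = A -\<^sub>o (B \<circ>\<^sub>m resolvent_op D (cnj l) \<circ>\<^sub>m C))) \<and>
        (self_adjoint (block_op A B C D) \<longleftrightarrow>
          (\<forall>l\<in>resolvent_set D.
             adjoint_op (A -\<^sub>o (B \<circ>\<^sub>m resolvent_op D l \<circ>\<^sub>m C))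
               = A -\<^sub>o (B \<circ>\<^sub>m resolvent_op D (cnj l) \<circ>\<^sub>m C)))" by (rule self_adjoint_block_iff)
  }
  {
    assume A: "A = adjoint_op A \<and> dom A \<subseteq> dom C"
    interpret symmetric_block D C B A
    proof
      show "self_adjoint A" using A assms(5) by (simp add: self_adjoint_def)
      show "closure (dom B) = UNIV" using assms(6) by (simp add: densely_defined_def)
      show "dom A \<subseteq> dom C" using A by blast
    qed (fact assms(1-4) dense D_symmetric CB)+
    show
      "(self_adjoint (block_op A B C D) \<longleftrightarrow>
          (\<exists>l\<in>resolvent_set A.
             adjoint_op (D -\<^sub>o (C \<circ>\<^sub>m resolvent_op A l \<circ>\<^sub>m B))
               = D -\<^sub>o (C \<circ>\<^sub>m resolvent_op A (cnj l) \<circ>\<^sub>m B))) \<and>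
        (self_adjoint (block_op A B C D) \<longleftrightarrow>
          (\<forall>l\<in>resolvent_set A.
             adjoint_op (D -\<^sub>o (C \<circ>\<^sub>m resolvent_op A l \<circ>\<^sub>m B))
               = D -\<^sub>o (C \<circ>\<^sub>m resolvent_op A (cnj l) \<circ>\<^sub>m B)))"
      \<comment> \<open>Here \<open>block_densely_defined\<close> comes from the exchanged instance
        and concerns \<open>block_op D C B A\<close>.\<close>
      unfolding self_adjoint_block_swap[OF assms(16) block_densely_defined]
      by (rule self_adjoint_block_iff)
  }
qed

end
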